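(* Let $\bar a$ be a composition with an even number of parts. If $\bar a$ is not of the form $(a,1,a,1)$ or $(1,a,1,a)$ for some positive integer $a$, then the rank polynomial of the circular fence poset $\bar F(\bar a)$ is unimodal.
   Context: A composition is a finite tuple of positive integers. For an even-length composition $\bar c=(c_1,\dots,c_{2s})$ with $n=c_1+\dots+c_{2s}$, the circular fence poset $\bar F(\bar c)$ is the poset on elements $x_1,\dots,x_n$ (indices cyclic, $x_{n+1}=x_1$) generated by the relations $$x_1\prec x_2\prec\dots\prec x_{c_1+1}\succ x_{c_1+2}\succ\dots\succ x_{c_1+c_2+1}\prec x_{c_1+c_2+2}\prec\dots\prec x_{1+\sum_{i=1}^{2s-1}c_i}\succ\dots\succ x_{n}\succ x_1,$$ i.e. going around the cycle one takes $c_1$ up steps, then $c_2$ down steps, then $c_3$ up steps, and so on. The rank polynomial of a finite poset $P$ is $\sum_I q^{|I|}$, summed over all lower ideals (down-closed subsets) $I$ of $P$. A polynomial $\sum_k r_kq^k$ of degree $n$ is unimodal if there is an $m$ with $r_0\le r_1\le\dots\le r_m\ge r_{m+1}\ge\dots\ge r_n$. *)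

theory Defs
  imports "HOL-Computational_Algebra.Polynomial"
begin

definition composition :: "nat list \<Rightarrow> bool" where
  "composition c \<longleftrightarrow> (\<forall>k\<in>set c. 0 < k)"

(* Entry i is True iff the i-th cyclic step goes up; blocks alternate, starting with an up block. *)
definition fence_steps :: "nat list \<Rightarrow> bool list" where
  "fence_steps c = concat (map (\<lambda>j. replicate (c ! j) (even j)) [0..<length c])"

(* The element x_(i+1) is represented by the number i, so indices are taken modulo n = sum_list c. *)
definition circular_fence_carrier :: "nat list \<Rightarrow> nat set" where
  "circular_fence_carrier c = {..<sum_list c}"

definition circular_fence_gen :: "nat list \<Rightarrow> nat rel" where
  "circular_fence_gen c =
     {(i, Suc i mod sum_list c) | i. i < sum_list c \<and> fence_steps c ! i} \<union>
     {(Suc i mod sum_list c, i) | i. i < sum_list c \<and> \<not> fence_steps c ! i}"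

definition circular_fence :: "nat list \<Rightarrow> nat rel" where
  "circular_fence c = Restr ((circular_fence_gen c)\<^sup>*) (circular_fence_carrier c)"

lemma Field_circular_fence: "Field (circular_fence c) = circular_fence_carrier c"
  by (auto simp: circular_fence_def Field_def)

(* A finite poset is given by its reflexive order relation r, with carrier Field r.
   Order_Relation.ofilter describes the down-closed subsets of Field r: under r y is the
   set of all x with (x, y) in r. *)
definition rank_polynomial :: "'a rel \<Rightarrow> nat poly" where
  "rank_polynomial r = (\<Sum>I | Order_Relation.ofilter r I. monom 1 (card I))"

definition unimodal :: "nat poly \<Rightarrow> bool" where
  "unimodal p \<longleftrightarrow>
     (\<exists>m\<le>degree p. (\<forall>k<m. coeff p k \<le> coeff p (Suc k)) \<and>
        (\<forall>k. m \<le> k \<and> k < degree p \<longrightarrow> coeff p (Suc k) \<le> coeff p k))"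

end

theory Submission
  imports Defs
begin

text \<open>
  Writing an ideal as a cyclic 0-1 sequence, the rank polynomial becomes the trace of the product
  \<open>U^c1 D^c2 U^c3 ...\<close> with \<open>U = [[1, 0], [q, q]]\<close> and \<open>D = [[1, 1], [0, q]]\<close>. The identity
  \<open>D U^a D = q U^a + D^(a + 2) + q^2 [a - 1]\<close>, where \<open>[m] = 1 + q + ... + q^(m - 1)\<close>, and its mirror
  image yield a recurrence with nonnegative coefficients,
  \<open>R(b, a, d, c) = q R(b - 1, a, d - 1, c) + R(a + b + d, c) + q^2 [a - 1] R(b + d - 2, c)\<close>.
  All three terms are centred at the same degree, so if they are sums of blocks \<open>q^j [n + 1 - 2 j]\<close>
  (which are symmetric, unimodal, and by Clebsch--Gordan closed under multiplication by \<open>[m]\<close>), so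
  is the left-hand side. A term may fail to be such a sum only if it is \<open>1 + q^n\<close>, coming from a
  word in a single letter, or belongs to an exceptional composition. With at least 8 parts these
  are avoided by taking \<open>b > 1\<close> (unless all parts are 1); with at most 6 parts the triple
  \<open>(b, a, d)\<close> is chosen case by case, or the block decomposition is written down explicitly.
\<close>

section \<open>Two-by-two matrices\<close>

datatype 'a mat2 = Mat2 'a 'a 'a 'a

instantiation mat2 :: (semiring_1) semiring_1
begin

definition zero_mat2 :: "'a mat2" where "0 = Mat2 0 0 0 0"
definition one_mat2 :: "'a mat2" where "1 = Mat2 1 0 0 1"
fun plus_mat2 :: "'a mat2 \<Rightarrow> 'a mat2 \<Rightarrow> 'a mat2" where
  "Mat2 a b c d + Mat2 a' b' c' d' = Mat2 (a + a') (b + b') (c + c') (d + d')"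
fun times_mat2 :: "'a mat2 \<Rightarrow> 'a mat2 \<Rightarrow> 'a mat2" where
  "Mat2 a b c d * Mat2 a' b' c' d' =
     Mat2 (a * a' + b * c') (a * b' + b * d') (c * a' + d * c') (c * b' + d * d')"

instance
proof
  fix x y z :: "'a mat2"
  show "x * y * z = x * (y * z)"
    by (cases x; cases y; cases z) (simp add: algebra_simps)
  show "x + y + z = x + (y + z)"
    by (cases x; cases y; cases z) (simp add: algebra_simps)
  show "x + y = y + x"
    by (cases x; cases y) (simp add: algebra_simps)
  show "(x + y) * z = x * z + y * z"
    by (cases x; cases y; cases z) (simp add: algebra_simps)
  show "x * (y + z) = x * y + x * z"
    by (cases x; cases y; cases z) (simp add: algebra_simps)
  show "0 + x = x" "0 * x = 0" "x * 0 = 0" "1 * x = x" "x * 1 = x"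
    by (cases x; simp add: zero_mat2_def one_mat2_def)+
  show "(0 :: 'a mat2) \<noteq> 1"
    by (simp add: zero_mat2_def one_mat2_def)
qed

end

fun trace2 :: "'a::semiring_1 mat2 \<Rightarrow> 'a" where
  "trace2 (Mat2 a b c d) = a + d"

fun scale2 :: "'a::semiring_1 \<Rightarrow> 'a mat2 \<Rightarrow> 'a mat2" where
  "scale2 r (Mat2 a b c d) = Mat2 (r * a) (r * b) (r * c) (r * d)"

text \<open>Rows and columns are indexed by membership bits, with \<open>False\<close>
  first.\<close>

fun entry2 :: "'a mat2 \<Rightarrow> bool \<Rightarrow> bool \<Rightarrow> 'a" where
  "entry2 (Mat2 a b c d) s t = (if s then (if t then d else c) else (if t then b else a))"

lemma trace2_add: "trace2 (x + y) = trace2 x + trace2 y"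
  by (cases x; cases y) (simp add: algebra_simps)

lemma trace2_commute: "trace2 (x * y) = trace2 (y * x)" for x y :: "'a::comm_semiring_1 mat2"
  by (cases x; cases y) (simp add: algebra_simps)

lemma trace2_scale: "trace2 (scale2 r x) = r * trace2 x"
  by (cases x) (simp add: algebra_simps)

lemma scale2_mult_left: "scale2 r x * y = scale2 r (x * y)"
  by (cases x; cases y) (simp add: algebra_simps)

lemma scale2_mult_right: "x * scale2 r y = scale2 r (x * y)"
  for x y :: "'a::comm_semiring_1 mat2"
  by (cases x; cases y) (simp add: algebra_simps)

lemma trace2_entry2: "trace2 x = entry2 x False False + entry2 x True True"
  by (cases x) simp

lemma entry2_mult:
  "entry2 (x * y) s t = entry2 x s False * entry2 y False t + entry2 x s True * entry2 y True t"
  by (cases x; cases y) simp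

section \<open>Symmetric unimodal polynomials\<close>

definition q :: "nat poly" where "q = monom 1 1"

definition qint :: "nat \<Rightarrow> nat poly" where
  "qint m = (\<Sum>i<m. q ^ i)"

lemma qint_0 [simp]: "qint 0 = 0"
  and qint_1 [simp]: "qint (Suc 0) = 1"
  and qint_Suc: "qint (Suc m) = qint m + q ^ m"
  by (simp_all add: qint_def)

lemma qint_add: "qint (m + k) = qint m + q ^ m * qint k"
  by (induction k) (simp_all add: qint_Suc algebra_simps power_add)

lemma qint_Suc': "qint (Suc m) = 1 + q * qint m"
  using qint_add[of 1 m] by simp

lemma coeff_q_qint: "coeff (q ^ j * qint m) k = (if j \<le> k \<and> k < j + m then 1 else 0)"
proof -
  have "q ^ j * qint m = (\<Sum>i<m. monom 1 (j + i))"
    by (simp add: q_def qint_def sum_distrib_left monom_power mult_monom)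
  also have "coeff \<dots> k = (\<Sum>i<m. if i = k - j then (if j \<le> k then 1 else 0) else 0)"
    unfolding coeff_sum by (intro sum.cong) auto
  also have "\<dots> = (if j \<le> k \<and> k < j + m then 1 else 0)"
    by (subst sum.delta) auto
  finally show ?thesis .
qed

text \<open>The cone of characters of SL(2) of the parity of \<open>n\<close>, with the variable normalised
  so that the weights run from 0 to \<open>n\<close>.\<close>
inductive sl2_char :: "nat \<Rightarrow> nat poly \<Rightarrow> bool" where
  zero: "sl2_char n 0"
| add_block: "sl2_char n p \<Longrightarrow> 2 * j \<le> n \<Longrightarrow> sl2_char n (q ^ j * qint (Suc n - 2 * j) + p)"

text \<open>Writing the symmetry as \<open>2 * j + m = Suc n\<close> avoids truncated subtraction
  and admits the empty block \<open>m = 0\<close>.\<close>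

lemma sl2_char_block:
  assumes "2 * j + m = Suc n"
  shows "sl2_char n (q ^ j * qint m)"
proof (cases "m = 0")
  case False
  then show ?thesis
    using sl2_char.add_block[OF sl2_char.zero, of j n] assms
    by (metis add_diff_cancel_left' add_leD1 add_0_right less_Suc_eq_le less_add_same_cancel1 neq0_conv)
qed (simp add: sl2_char.zero)

lemma sl2_char_add: "sl2_char n p \<Longrightarrow> sl2_char n p' \<Longrightarrow> sl2_char n (p + p')"
  by (induction rule: sl2_char.induct) (simp_all add: add.assoc sl2_char.add_block)

lemma sl2_char_shift:
  assumes "sl2_char n p" "n' = n + 2 * i"
  shows "sl2_char n' (q ^ i * p)"
  using assms
proof induction
  case (add_block n p j)
  have "q ^ i * (q ^ j * qint (Suc n - 2 * j) + p)
      = q ^ (i + j) * qint (Suc n' - 2 * (i + j)) + q ^ i * p"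
    using add_block.prems by (simp add: power_add algebra_simps)
  moreover have "sl2_char n' (q ^ (i + j) * qint (Suc n' - 2 * (i + j)) + q ^ i * p)"
    using add_block by (intro sl2_char.add_block) auto
  ultimately show ?case
    by simp
qed (simp add: sl2_char.zero)

text \<open>One Clebsch-Gordan step: the longest block splits off and both remaining factors shrink
  by one.\<close>

lemma qint_mult: "qint (Suc k) * qint (Suc l) = qint (Suc (k + l)) + q * (qint k * qint l)"
proof -
  have "qint (Suc k) * qint (Suc l) = qint (Suc k) + q * (qint k + q ^ k) * qint l"
    by (simp add: qint_Suc'[of l] qint_Suc[of k] algebra_simps)
  also have "\<dots> = (qint (Suc k) + q ^ Suc k * qint l) + q * (qint k * qint l)"
    by (simp add: algebra_simps)
  also have "qint (Suc k) + q ^ Suc k * qint l = qint (Suc (k + l))"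
    using qint_add[of "Suc k" l] by simp
  finally show ?thesis .
qed

lemma sl2_char_qint_mult: "n + 2 = k + l \<Longrightarrow> sl2_char n (qint k * qint l)"
proof (induction k arbitrary: l n)
  case (Suc k)
  show ?case
  proof (cases l)
    case (Suc l')
    have "sl2_char n (q ^ 1 * (qint k * qint l'))"
    \<comment> \<open>For \<open>n < 2\<close> the index \<open>n - 2\<close> would be truncated,
      but then one factor is \<open>qint 0\<close>.\<close>
    proof (cases "n < 2")
      case True
      then have "k = 0 \<or> l' = 0"
        using Suc.prems \<open>l = Suc l'\<close> by auto
      then show ?thesis
        by (auto simp: sl2_char.zero)
    next
      case False
      then show ?thesis
        using Suc.prems \<open>l = Suc l'\<close> by (intro sl2_char_shift[OF Suc.IH[of "n - 2"]]) auto
    qed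
    moreover have "sl2_char n (q ^ 0 * qint (Suc (k + l')))"
      using Suc.prems \<open>l = Suc l'\<close> by (intro sl2_char_block) auto
    ultimately show ?thesis
      using \<open>l = Suc l'\<close> by (simp add: qint_mult sl2_char_add)
  qed (simp add: sl2_char.zero)
qed (simp add: sl2_char.zero)

lemma sl2_char_mult_qint:
  assumes "sl2_char n p" "n' + 1 = n + k"
  shows "sl2_char n' (qint k * p)"
  using assms
proof induction
  case (add_block n p j)
  show ?case
  proof (cases k)
    case (Suc k')
    have "sl2_char n' (q ^ j * (qint k * qint (Suc n - 2 * j)))"
      using add_block.hyps add_block.prems Suc
      by (intro sl2_char_shift[OF sl2_char_qint_mult[where n = "n' - 2 * j"]]) auto
    then show ?thesis
      using sl2_char_add[OF _ add_block.IH[OF add_block.prems]]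
      by (simp add: distrib_left mult.left_commute)
  qed (simp add: sl2_char.zero)
qed (simp add: sl2_char.zero)

text \<open>A block occupies the degrees \<open>j\<close> to \<open>n - j\<close>, symmetric about
  n/2, so a step up from below the centre cannot leave it.\<close>

lemma sl2_char_coeff_incr:
  assumes "sl2_char n p" "2 * k + 1 \<le> n"
  shows "coeff p k \<le> coeff p (Suc k)"
  using assms by induction (auto simp: coeff_q_qint intro!: add_mono)

lemma sl2_char_coeff_decr:
  assumes "sl2_char n p" "n \<le> 2 * k + 1"
  shows "coeff p (Suc k) \<le> coeff p k"
  using assms by induction (auto simp: coeff_q_qint intro!: add_mono)

text \<open>Every block contains degree \<open>n div 2\<close>; this keeps the peak within
  \<open>degree p\<close>, as \<open>unimodal\<close> demands.\<close>

lemma sl2_char_coeff_middle: "sl2_char n p \<Longrightarrow> p = 0 \<or> coeff p (n div 2) \<noteq> 0"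
  by (induction rule: sl2_char.induct) (auto simp: coeff_q_qint)

lemma sl2_char_unimodal:
  assumes "sl2_char n p"
  shows "unimodal p"
proof (cases "p = 0")
  case False
  then have "n div 2 \<le> degree p"
    using sl2_char_coeff_middle[OF assms] le_degree by blast
  moreover have "coeff p k \<le> coeff p (Suc k)" if "k < n div 2" for k
    using that by (intro sl2_char_coeff_incr[OF assms]) simp
  moreover have "coeff p (Suc k) \<le> coeff p k" if "n div 2 \<le> k" for k
    using that by (intro sl2_char_coeff_decr[OF assms]) simp
  ultimately show ?thesis
    unfolding unimodal_def by blast
qed (simp add: unimodal_def)

section \<open>Transfer matrices\<close>

text \<open>The row is the bit of the current element, the column that of the next. Membership of
  the current element gives the weight \<open>q\<close>; the zero marks the pair that down-closure
  forbids.\<close>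

fun step_mat :: "bool \<Rightarrow> nat poly mat2" where
  "step_mat True = Mat2 1 0 q q"
| "step_mat False = Mat2 1 1 0 q"

fun fence_mat :: "bool \<Rightarrow> nat list \<Rightarrow> nat poly mat2" where
  "fence_mat u [] = 1"
| "fence_mat u (k # c) = step_mat u ^ k * fence_mat (\<not> u) c"

definition fence_poly :: "bool \<Rightarrow> nat list \<Rightarrow> nat poly" where
  "fence_poly u c = trace2 (fence_mat u c)"

lemma step_mat_power_up: "step_mat True ^ k = Mat2 1 0 (q * qint k) (q ^ k)"
  by (induction k) (simp_all add: one_mat2_def qint_Suc' algebra_simps)

lemma step_mat_power_down: "step_mat False ^ k = Mat2 1 (qint k) 0 (q ^ k)"
  by (induction k) (simp_all add: one_mat2_def qint_Suc algebra_simps)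

lemma step_mat_exchange:
  "step_mat u * step_mat (\<not> u) ^ Suc a * step_mat u =
     scale2 q (step_mat (\<not> u) ^ Suc a) + step_mat u ^ (a + 3) + scale2 (q\<^sup>2 * qint a) 1"
proof -
  have a3: "qint (a + 3) = 1 + q * qint (Suc a) + q ^ (a + 2)"
    using qint_Suc[of "a + 2"] qint_Suc'[of "a + 1"] by (simp add: numeral_3_eq_3)
  have pow: "q ^ (a + 3) = q * (q * (q * q ^ a))" "q ^ (a + 2) = q * (q * q ^ a)"
    by (simp_all add: numeral_3_eq_3)
  have "step_mat True * step_mat False ^ Suc a * step_mat True =
     scale2 q (step_mat False ^ Suc a) + step_mat True ^ (a + 3) + scale2 (q\<^sup>2 * qint a) 1"
    unfolding step_mat_power_up step_mat_power_down
    unfolding one_mat2_def step_mat.simps times_mat2.simps plus_mat2.simps scale2.simps mat2.inject a3 pow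
    \<comment> \<open>Some entries need the lowest term of \<open>qint\<close> peeled off, others
      the highest, so the alternatives are tried entry by entry.\<close>
    by (intro conjI)
      ((simp add: qint_Suc' power2_eq_square algebra_simps; fail) |
       (simp add: qint_Suc power2_eq_square algebra_simps; fail) |
       (simp add: power2_eq_square algebra_simps; fail))+
  moreover have "step_mat False * step_mat True ^ Suc a * step_mat False =
     scale2 q (step_mat True ^ Suc a) + step_mat False ^ (a + 3) + scale2 (q\<^sup>2 * qint a) 1"
    unfolding step_mat_power_up step_mat_power_down
    unfolding one_mat2_def step_mat.simps times_mat2.simps plus_mat2.simps scale2.simps mat2.inject a3 pow
    by (intro conjI)
      ((simp add: qint_Suc' power2_eq_square algebra_simps; fail) |
       (simp add: qint_Suc power2_eq_square algebra_simps; fail) |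
       (simp add: power2_eq_square algebra_simps; fail))+
  ultimately show ?thesis
    by (cases u) simp_all
qed

section \<open>Rotation, merging and the exchange recurrence\<close>

lemma fence_mat_append:
  "fence_mat u (c @ d) = fence_mat u c * fence_mat (if even (length c) then u else \<not> u) d"
  by (induction c arbitrary: u) (auto simp: mult.assoc)

text \<open>Cyclicity of the trace. Even total length keeps the directions alternating across the
  seam.\<close>

lemma fence_poly_rotate:
  assumes "even (length (c @ d))"
  shows "fence_poly u (c @ d) = fence_poly (if even (length c) then u else \<not> u) (d @ c)"
  using assms by (auto simp: fence_poly_def fence_mat_append trace2_commute)

lemma fence_poly_merge: "fence_poly u (x # 0 # y # c) = fence_poly u ((x + y) # c)"
  by (simp add: fence_poly_def power_add mult.assoc)

text \<open>\<open>step_mat_exchange\<close> is applied to the middle block together with the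
  adjacent letter on each side.\<close>

lemma fence_poly_exchange:
  "fence_poly u (Suc b # Suc a # Suc d # c) =
     q * fence_poly u (b # Suc a # d # c) + fence_poly u ((a + b + d + 3) # c)
     + q\<^sup>2 * qint a * fence_poly u ((b + d) # c)"
proof -
  let ?S = "step_mat u" and ?T = "step_mat (\<not> u)" and ?X = "fence_mat (\<not> u) c"
  have "fence_mat u (Suc b # Suc a # Suc d # c)
      = ?S ^ b * (?S * ?T ^ Suc a * ?S) * ?S ^ d * ?X"
    by (simp only: fence_mat.simps power_Suc2[of ?S b] power_Suc[of ?S d] mult.assoc not_not)
  also have "\<dots> = scale2 q (fence_mat u (b # Suc a # d # c)) + fence_mat u ((a + b + d + 3) # c)
      + scale2 (q\<^sup>2 * qint a) (fence_mat u ((b + d) # c))"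
  proof -
    have "a + b + d + 3 = b + (a + 3) + d" by simp
    then have "fence_mat u ((a + b + d + 3) # c) = ?S ^ b * ?S ^ (a + 3) * ?S ^ d * ?X"
      by (simp only: fence_mat.simps power_add)
    moreover have "?S ^ b * (?S * ?T ^ Suc a * ?S) * ?S ^ d * ?X =
        scale2 q (?S ^ b * ?T ^ Suc a * ?S ^ d * ?X) + ?S ^ b * ?S ^ (a + 3) * ?S ^ d * ?X
        + scale2 (q\<^sup>2 * qint a) (?S ^ b * ?S ^ d * ?X)"
      by (simp only: step_mat_exchange distrib_left distrib_right scale2_mult_left
          scale2_mult_right mult_1_right)
    ultimately show ?thesis
      by (simp only: fence_mat.simps not_not power_add[of ?S b d] mult.assoc)
  qed
  finally show ?thesis
    by (simp only: fence_poly_def trace2_add trace2_scale)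
qed

text \<open>Quantifying over the direction of the first block makes this invariant under rotations of an
  even-length \<open>c\<close>. Parts may be 0.\<close>
definition fence_ok :: "nat list \<Rightarrow> bool" where
  "fence_ok c \<longleftrightarrow> (\<forall>u. sl2_char (sum_list c) (fence_poly u c))"

lemma fence_ok_rotate:
  assumes "even (length (c @ d))" "fence_ok (d @ c)"
  shows "fence_ok (c @ d)"
  using assms(2) unfolding fence_ok_def fence_poly_rotate[OF assms(1)] by (simp add: add.commute)

lemma fence_ok_rotate1:
  assumes "fence_ok (c @ [x])" "odd (length c)"
  shows "fence_ok (x # c)"
  using fence_ok_rotate[of "[x]" c] assms by simp

lemma fence_ok_merge: "fence_ok ((x + y) # c) \<Longrightarrow> fence_ok (x # 0 # y # c)"
  by (simp add: fence_ok_def fence_poly_merge add.assoc)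

text \<open>The factors \<open>q\<close> and \<open>q\<^sup>2 * qint a\<close> make up exactly for
  the smaller sums, so all terms share one centre. For \<open>a = 0\<close> the last term
  vanishes.\<close>

lemma fence_ok_exchange:
  assumes "fence_ok (b # Suc a # d # c)" "fence_ok ((a + b + d + 3) # c)"
    and "a \<noteq> 0 \<Longrightarrow> fence_ok ((b + d) # c)"
  shows "fence_ok (Suc b # Suc a # Suc d # c)"
  unfolding fence_ok_def
proof
  fix u
  let ?n = "sum_list (Suc b # Suc a # Suc d # c)"
  have "sl2_char ?n (q ^ 1 * fence_poly u (b # Suc a # d # c))"
    using assms(1) unfolding fence_ok_def by (intro sl2_char_shift[where n = "?n - 2"]) auto
  moreover have "sl2_char ?n (fence_poly u ((a + b + d + 3) # c))"
    using assms(2) unfolding fence_ok_def by (simp add: numeral_3_eq_3 add_ac)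
  moreover have "sl2_char ?n (q\<^sup>2 * (qint a * fence_poly u ((b + d) # c)))"
  proof (cases a)
    case (Suc a')
    then show ?thesis
      using assms(3) unfolding fence_ok_def
      by (intro sl2_char_shift[OF sl2_char_mult_qint[where n' = "?n - 4"]]) (auto simp: add.assoc)
  qed (simp add: sl2_char.zero)
  ultimately show "sl2_char ?n (fence_poly u (Suc b # Suc a # Suc d # c))"
    unfolding fence_poly_exchange by (simp add: sl2_char_add mult.assoc)
qed

section \<open>Base cases: two parts, and explicit four-part words\<close>

lemma fence_poly_two:
  "fence_poly u [Suc a, Suc b] = qint (a + b + 3) + q\<^sup>2 * (qint a * qint b)"
proof -
  have "fence_poly u [Suc a, Suc b] = 1 + q * (qint (Suc a) * qint (Suc b)) + q ^ (a + b + 2)"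
    by (cases u) (simp_all only: fence_poly_def fence_mat.simps step_mat_power_up step_mat_power_down,
      simp_all only: not_True_eq_False not_False_eq_True step_mat_power_up step_mat_power_down,
      simp_all add: one_mat2_def power_add algebra_simps power2_eq_square)
  \<comment> \<open>After one Clebsch-Gordan step the outer terms 1 and
    \<open>q ^ (a + b + 2)\<close> complete the long block.\<close>
  also have "\<dots> = qint (a + b + 3) + q\<^sup>2 * (qint a * qint b)"
    using qint_Suc[of "a + b + 2"] qint_Suc'[of "a + b + 1"]
    by (simp add: qint_mult numeral_3_eq_3 power2_eq_square algebra_simps)
  finally show ?thesis .
qed

lemma fence_ok_two:
  assumes "0 < a" "0 < b"
  shows "fence_ok [a, b]"
proof -
  obtain a' b' where ab: "a = Suc a'" "b = Suc b'"
    using assms by (auto simp: gr0_conv_Suc)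
  have "sl2_char (a + b) (q ^ 0 * qint (a' + b' + 3))"
    using ab by (intro sl2_char_block) auto
  moreover have "sl2_char (a + b) (q\<^sup>2 * (qint a' * qint b'))"
  proof (cases "a' = 0 \<or> b' = 0")
    case False
    then show ?thesis
      using ab by (intro sl2_char_shift[OF sl2_char_qint_mult[where n = "a + b - 4"]]) auto
  qed (auto simp: sl2_char.zero)
  ultimately show ?thesis
    using ab by (simp add: fence_ok_def fence_poly_two sl2_char_add)
qed

text \<open>A word in a single letter. For \<open>k \<ge> 2\<close> the value has a gap in the
  middle and lies outside the cone.\<close>

lemma fence_poly_zero: "fence_poly u [0, k] = 1 + q ^ k"
  by (cases u)
    (simp_all add: fence_poly_def step_mat_power_up step_mat_power_down del: step_mat.simps)

lemma fence_poly_zero_zero: "fence_poly u [0, a, 0, c] = 1 + q ^ (a + c)"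
proof -
  have "fence_poly u [0, a, 0, c] = fence_poly (\<not> u) [a, 0, c, 0]"
    using fence_poly_rotate[of "[0]" "[a, 0, c]" u] by simp
  also have "\<dots> = fence_poly u [0, a + c]"
    using fence_poly_rotate[of "[a + c]" "[0]" "\<not> u"] by (simp add: fence_poly_merge)
  finally show ?thesis
    by (simp add: fence_poly_zero)
qed

text \<open>Here the exchange produces one-letter words, which in general are outside the cone;
  their terms have to be regrouped with the others.\<close>

lemma fence_poly_ones:
  "fence_poly u [Suc 0, Suc a, Suc 0, Suc c] =
     q + q ^ (a + c + 3) + qint (a + c + 5) + q\<^sup>2 * (qint (a + 2) * qint c)
     + q\<^sup>2 * qint a + q ^ (c + 3) * qint a"
proof -
  have "fence_poly u [a + 3, Suc c] = qint (a + c + 5) + q\<^sup>2 * (qint (a + 2) * qint c)"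
    using fence_poly_two[of u "a + 2" c] by (simp add: numeral_eq_Suc)
  then show ?thesis
    unfolding fence_poly_exchange[of u 0 a 0 "[Suc c]"]
    by (simp add: fence_poly_zero_zero fence_poly_zero distrib_left power_add power2_eq_square
        power3_eq_cube mult_ac add_ac)
qed

lemma fence_ok_ones_less:
  assumes "0 < c" "c < a"
  shows "fence_ok [1, a, 1, c]"
proof -
  obtain a' c' where ac: "a = Suc a'" "c = Suc c'"
    using assms by (intro that[of "a - 1" "c - 1"]) auto
  let ?n = "a' + c' + 4"
  have "sl2_char ?n (fence_poly u [Suc 0, Suc a', Suc 0, Suc c'])" for u
  proof (cases c')
    case 0
    then obtain e where e: "a' = Suc e"
      using assms ac by (intro that[of "a' - 1"]) auto
    \<comment> \<open>The two blocks of length \<open>a'\<close> are replaced by their union and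
      intersection; the union absorbs the end terms \<open>q\<close> and
      \<open>q ^ (a' + 3)\<close>.\<close>
    have "fence_poly u [Suc 0, Suc a', Suc 0, Suc c']
        = q ^ 0 * qint (a' + 5) + q ^ 1 * qint (a' + 3) + q ^ 3 * qint e"
      unfolding fence_poly_ones 0
      by (simp add: e qint_Suc'[of "Suc (Suc (Suc e))"] numeral_eq_Suc)
        (simp add: qint_Suc algebra_simps)
    also have "sl2_char ?n \<dots>"
      using 0 e by (intro sl2_char_add sl2_char_block) auto
    finally show ?thesis .
  next
    case (Suc d)
    then obtain e where e: "a' = d + 2 + e"
      using assms ac by (intro that[of "a' - (d + 2)"]) auto
    \<comment> \<open>Two off-centre blocks become their union and intersection, both centred. The
      union has no gap because \<open>a' \<ge> d + 2\<close>, which is where \<open>c < a\<close>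
      enters.\<close>
    have upper: "qint a' + q ^ (d + 2) * qint a' = qint (a' + d + 2) + q ^ (d + 2) * qint e"
      using qint_add[of "d + 2" a'] qint_add[of "d + 2" e] e by (simp add: algebra_simps)
    \<comment> \<open>The longest block of the product fills the gap between the two isolated end
      terms.\<close>
    have lower: "q + q\<^sup>2 * (qint (a' + 2) * qint (Suc d)) + q ^ (a' + d + 4)
        = q * qint (a' + d + 4) + q ^ 3 * (qint (a' + 1) * qint d)"
      using qint_mult[of "a' + 1" d] qint_Suc'[of "a' + d + 3"] qint_Suc[of "a' + d + 2"]
      by (simp add: numeral_eq_Suc algebra_simps)
    have "fence_poly u [Suc 0, Suc a', Suc 0, Suc c'] =
        (q + q\<^sup>2 * (qint (a' + 2) * qint (Suc d)) + q ^ (a' + d + 4)) + qint (?n + 1)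
        + q\<^sup>2 * (qint a' + q ^ (d + 2) * qint a')"
      unfolding fence_poly_ones Suc by (simp add: numeral_eq_Suc algebra_simps)
    also have "\<dots> = q ^ 0 * qint (?n + 1) + q ^ 1 * qint (a' + d + 4)
        + q ^ 3 * (qint (a' + 1) * qint d) + q ^ 2 * qint (a' + d + 2) + q ^ (d + 4) * qint e"
      unfolding upper lower by (simp add: numeral_eq_Suc algebra_simps)
    also have "sl2_char ?n \<dots>"
    proof -
      have "sl2_char ?n (q ^ 3 * (qint (a' + 1) * qint d))"
      proof (cases d)
        case (Suc d')
        then show ?thesis
          using \<open>c' = Suc d\<close>
          by (intro sl2_char_shift[OF sl2_char_qint_mult[where n = "?n - 6"]]) auto
      qed (simp add: sl2_char.zero)
      then show ?thesis
        using Suc e by (intro sl2_char_add sl2_char_block) auto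
    qed
    finally show ?thesis .
  qed
  then show ?thesis
    by (simp add: fence_ok_def ac numeral_eq_Suc)
qed

lemma fence_ok_ones:
  assumes "0 < a" "0 < c" "a \<noteq> c"
  shows "fence_ok [1, a, 1, c]"
  using assms fence_ok_ones_less[of a c] fence_ok_ones_less[of c a] fence_ok_rotate[of "[1, a]" "[1, c]"]
  by (cases "a < c") auto

text \<open>Every exchange here leads to the exceptional word 1, 2, 1, 2 up to rotation, so the
  blocks are listed explicitly.\<close>

lemma fence_ok_twos: "fence_ok [2, 2, 2, 2]"
proof -
  have "fence_poly u [2, 2, 2, 2]
      = q ^ 0 * qint 9 + q ^ 1 * qint 7 + q ^ 2 * qint 5 + q ^ 2 * qint 5 + q ^ 2 * qint 5
        + q ^ 3 * qint 3" for u
    using fence_poly_exchange[of u 1 1 1 "[2]"] fence_poly_ones[of u 1 1]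
      fence_poly_two[of u 5 1] fence_poly_two[of u 1 1]
    by (simp add: numeral_eq_Suc) (simp add: qint_Suc algebra_simps)
  also have "sl2_char 8 \<dots>"
    by (intro sl2_char_add sl2_char_block) auto
  finally show ?thesis
    by (simp add: fence_ok_def)
qed

lemma fence_ok_exchange':
  assumes "0 < b" "0 < a" "0 < d"
    and "fence_ok ((b - 1) # a # (d - 1) # c)" "fence_ok ((a + b + d) # c)"
    and "a \<noteq> 1 \<Longrightarrow> fence_ok ((b + d - 2) # c)"
  shows "fence_ok (b # a # d # c)"
proof -
  obtain b' a' d' where "b = Suc b'" "a = Suc a'" "d = Suc d'"
    using assms(1-3) by (auto simp: gr0_conv_Suc)
  then show ?thesis
    using fence_ok_exchange[of b' a' d' c] assms(4-6) by (simp add: numeral_3_eq_3 add_ac)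
qed

section \<open>Positivity for all compositions\<close>

lemma fence_ok_four_one:
  assumes "0 < a" "2 \<le> b" "0 < c"
  shows "fence_ok [1, a, b, c]"
proof (rule fence_ok_exchange')
  \<comment> \<open>The part 1 drops to 0 and its neighbours \<open>c\<close> and \<open>a\<close>
    fuse, leaving two nonzero parts.\<close>
  have "fence_ok [c, 0, a, b - 1]"
    using assms by (intro fence_ok_merge fence_ok_two) auto
  then show "fence_ok [1 - 1, a, b - 1, c]"
    using fence_ok_rotate[of "[0, a, b - 1]" "[c]"] by simp
qed (use assms in \<open>auto intro!: fence_ok_two\<close>)

lemma fence_ok_four_one':
  assumes "2 \<le> a" "0 < b" "0 < c"
  shows "fence_ok [a, b, 1, c]"
  using fence_ok_rotate[of "[a, b]" "[1, c]"] fence_ok_four_one[of c a b] assms by simp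

text \<open>Exchange lowers \<open>b\<close> and \<open>d\<close> together. It hits an exceptional
  word only if \<open>b = d = 2\<close> and \<open>a = c\<close>; then the other opposite pair is
  lowered instead.\<close>

lemma fence_ok_four_big:
  assumes "2 \<le> a" "2 \<le> c" "0 < b" "0 < d" "\<not> (b = 1 \<and> d = 1 \<and> a = c)"
  shows "fence_ok [b, a, d, c]"
  using assms
proof (induction "b + a + d + c" arbitrary: a b c d rule: less_induct)
  case less
  consider "b = 1" "d = 1" | "b = 1" "2 \<le> d" | "2 \<le> b" "d = 1"
    | "2 \<le> b" "2 \<le> d" "\<not> (b = 2 \<and> d = 2 \<and> a = c)"
    | "b = 2" "d = 2" "a = c" "3 \<le> a" | "b = 2" "d = 2" "a = c" "a = 2"
  proof -
    have "b = 1 \<or> 2 \<le> b" "d = 1 \<or> 2 \<le> d" "a = 2 \<or> 3 \<le> a"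
      using less.prems by linarith+
    then show ?thesis
      using that by blast
  qed
  then show ?case
  proof cases
    case 1
    then show ?thesis
      using less.prems fence_ok_ones[of a c] by auto
  next
    case 2
    then show ?thesis
      using less.prems fence_ok_four_one[of a d c] by auto
  next
    case 3
    then show ?thesis
      using less.prems fence_ok_four_one'[of b a c] by auto
  next
    case 4
    have "fence_ok [b - 1, a, d - 1, c]"
      using 4 less.prems by (intro less.hyps) auto
    then show ?thesis
      by (rule fence_ok_exchange'[rotated 3])
        (use 4 less.prems in \<open>auto intro!: fence_ok_two\<close>)
  next
    case 5
    have "fence_ok [a - 1, 2, a - 1, 2]"
      using 5 by (intro less.hyps) auto
    then have "fence_ok [a, 2, a, 2]"
      by (rule fence_ok_exchange'[rotated 3]) (use 5 in \<open>auto intro!: fence_ok_two\<close>)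
    then show ?thesis
      using 5 fence_ok_rotate1[of "[a, 2, a]" 2] by simp
  next
    case 6
    then show ?thesis
      by (simp add: fence_ok_twos)
  qed
qed

definition exceptional :: "nat list \<Rightarrow> bool" where
  "exceptional c \<longleftrightarrow> (\<exists>k. c = [k, 1, k, 1] \<or> c = [1, k, 1, k])"

text \<open>The cases record which opposite pairs contain a 1; rotation by one interchanges the two
  pairs.\<close>

lemma fence_ok_four:
  assumes "0 \<notin> {b, a, d, c}" "\<not> exceptional [b, a, d, c]"
  shows "fence_ok [b, a, d, c]"
proof -
  have pos: "0 < b" "0 < a" "0 < d" "0 < c"
    using assms(1) by auto
  have rot: "fence_ok [b, a, d, c]" if "fence_ok [a, d, c, b]"
    using that fence_ok_rotate1[of "[a, d, c]" b] by simp
  consider "b = 1" "d = 1" | "a = 1" "c = 1" | "b = 1" "2 \<le> d" | "2 \<le> b" "d = 1"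
    | "a = 1" "2 \<le> c" | "2 \<le> a" "c = 1" | "2 \<le> a" "2 \<le> c" "2 \<le> b" "2 \<le> d"
  proof -
    have "b = 1 \<or> 2 \<le> b" "d = 1 \<or> 2 \<le> d" "a = 1 \<or> 2 \<le> a" "c = 1 \<or> 2 \<le> c"
      using pos by linarith+
    then show ?thesis
      using that by blast
  qed
  then show ?thesis
  proof cases
    case 1
    then show ?thesis
      using assms fence_ok_ones[of a c] by (auto simp: exceptional_def)
  next
    case 2
    then show ?thesis
      using assms fence_ok_ones[of d b] rot by (auto simp: exceptional_def)
  next
    case 3
    then show ?thesis
      using assms fence_ok_four_one[of a d c] by auto
  next
    case 4
    then show ?thesis
      using assms fence_ok_four_one'[of b a c] by auto
  next
    case 5
    then show ?thesis
      using assms fence_ok_four_one[of d c b] rot by auto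
  next
    case 6
    then show ?thesis
      using assms fence_ok_four_one'[of a d b] rot by auto
  next
    case 7
    then show ?thesis
      by (intro fence_ok_four_big) auto
  qed
qed

section \<open>Six parts\<close>

lemma fence_ok_six_ones_aux:
  assumes "0 \<notin> {a, x, y, z}" "\<not> (x = 1 \<and> z = 1 \<and> y = a + 2)"
  shows "fence_ok [1, a, 1, x, y, z]"
proof (rule fence_ok_exchange')
  have "fence_ok [z, 0, a, 0, x, y]"
    using assms(1) by (intro fence_ok_merge fence_ok_two) auto
  then show "fence_ok [1 - 1, a, 1 - 1, x, y, z]"
    using fence_ok_rotate[of "[0, a, 0, x, y]" "[z]"] by simp
  \<comment> \<open>The second hypothesis excludes precisely the exceptional case of this
    word.\<close>
  show "fence_ok [a + 1 + 1, x, y, z]"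
    using assms by (intro fence_ok_four) (auto simp: exceptional_def)
  have "fence_ok [z, 0, x, y]"
    using assms(1) by (intro fence_ok_merge fence_ok_two) auto
  then show "fence_ok [1 + 1 - 2, x, y, z]"
    using fence_ok_rotate[of "[0, x, y]" "[z]"] by simp
qed (use assms in auto)

lemma fence_ok_six_ones:
  assumes "0 \<notin> {a, x, y, z}"
  shows "fence_ok [1, a, 1, x, y, z]"
proof (cases "x = 1 \<and> z = 1 \<and> y = a + 2")
  case True
  \<comment> \<open>After rotation by three the excluded case would read \<open>a = y + 2\<close>,
    contradicting \<open>y = a + 2\<close>.\<close>
  then have "fence_ok [x, y, z, 1, a, 1]"
    using assms fence_ok_six_ones_aux[of y 1 a 1] by auto
  then show ?thesis
    using fence_ok_rotate[of "[1, a, 1]" "[x, y, z]"] by simp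
qed (use assms fence_ok_six_ones_aux in auto)

text \<open>Both four-part words start with an entry at least 2, so they could be exceptional only
  if \<open>x = z = 1\<close>.\<close>

lemma fence_ok_six_big:
  assumes "2 \<le> b" "2 \<le> d" "0 \<notin> {a, x, y, z}" "\<not> (x = 1 \<and> z = 1)"
    and "fence_ok [b - 1, a, d - 1, x, y, z]"
  shows "fence_ok [b, a, d, x, y, z]"
proof (rule fence_ok_exchange')
  show "fence_ok [a + b + d, x, y, z]"
    using assms by (intro fence_ok_four) (auto simp: exceptional_def)
  show "fence_ok [b + d - 2, x, y, z]"
    using assms by (intro fence_ok_four) (auto simp: exceptional_def)
qed (use assms in auto)

section \<open>Eight or more parts\<close>

lemma fence_ok_long:
  assumes IH: "\<And>c'. sum_list c' + length c' < sum_list (b # a # d # c) + length (b # a # d # c) \<Longrightarrow>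
      0 \<notin> set c' \<Longrightarrow> even (length c') \<Longrightarrow> 6 \<le> length c' \<Longrightarrow> fence_ok c'"
    and "2 \<le> b" "0 < a" "0 < d" "0 \<notin> set c" "odd (length c)" "5 \<le> length c"
  shows "fence_ok (b # a # d # c)"
proof (rule fence_ok_exchange')
  show "fence_ok ((b - 1) # a # (d - 1) # c)"
  \<comment> \<open>For \<open>d = 1\<close> a zero part appears and fuses \<open>a\<close> with the
    head of \<open>c\<close>; at least six parts remain.\<close>
  proof (cases "d = 1")
    case True
    obtain x c' where c: "c = x # c'"
      using assms by (cases c) auto
    have "fence_ok ((a + x) # c' @ [b - 1])"
      using assms c by (intro IH) auto
    then have "fence_ok (a # 0 # c @ [b - 1])"
      by (simp add: c fence_ok_merge)
    then show ?thesis
      using assms True fence_ok_rotate1[of "a # 0 # c" "b - 1"] by simp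
  next
    case False
    then show ?thesis
      using assms by (intro IH) auto
  qed
qed (use assms in \<open>auto intro!: IH\<close>)

text \<open>With middle part 1 the third exchange term vanishes. In the first, two zeros fuse three
  ones into a 3.\<close>

lemma fence_ok_all_ones:
  assumes IH: "\<And>c. 0 \<notin> set c \<Longrightarrow> even (length c) \<Longrightarrow> 4 \<le> length c \<Longrightarrow> length c < k + 3 \<Longrightarrow>
      sum_list c \<le> k + 3 \<Longrightarrow> \<not> exceptional c \<Longrightarrow> fence_ok c"
    and "odd k" "5 \<le> k"
  shows "fence_ok (1 # 1 # 1 # replicate k 1)"
proof (rule fence_ok_exchange')
  obtain l where k: "k = Suc (Suc l)" "3 \<le> l"
    using assms(3) by (intro that[of "k - 2"]) auto
  have not_exceptional: "\<not> exceptional (3 # replicate j 1)" for j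
    by (auto simp: exceptional_def set_replicate_conv_if dest!: arg_cong[where f = set] split: if_splits)
  then have "fence_ok (3 # replicate l 1)"
    using assms k by (intro IH) (auto simp: sum_list_replicate)
  then have "fence_ok (1 # 0 # 1 # 0 # 1 # replicate l 1)"
    by (intro fence_ok_merge) (simp add: numeral_eq_Suc)
  then have "fence_ok (0 # 1 # 0 # 1 # replicate l 1 @ [1])"
    using fence_ok_rotate[of "0 # 1 # 0 # 1 # replicate l 1" "[1]"] assms k by simp
  moreover have "replicate k (1::nat) = 1 # replicate l 1 @ [1]"
    by (simp add: k replicate_append_same)
  ultimately show "fence_ok ((1 - 1) # 1 # (1 - 1) # replicate k 1)"
    by simp
  show "fence_ok ((1 + 1 + 1) # replicate k 1)"
    using assms not_exceptional[of k] by (intro IH) (auto simp: numeral_3_eq_3 sum_list_replicate)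
qed auto

lemma fence_ok_composition:
  assumes "0 \<notin> set c" "even (length c)" "c \<noteq> []" "\<not> exceptional c"
  shows "fence_ok c"
  using assms
\<comment> \<open>Fusing three blocks keeps the sum and only shortens the list, so the measure
  includes the length.\<close>
proof (induction "sum_list c + length c" arbitrary: c rule: less_induct)
  case less
  consider (two) b a where "c = [b, a]" | (four) b a d e where "c = [b, a, d, e]"
    | (six) b a d x y z where "c = [b, a, d, x, y, z]" | (long) "8 \<le> length c"
  proof -
    obtain m where m: "length c = 2 * m"
      using less.prems(2) by (elim evenE)
    have "m \<noteq> 0"
      using less.prems(3) m by (cases m) auto
    then have "length c = 2 \<or> length c = 4 \<or> length c = 6 \<or> 8 \<le> length c"
      using m by presburger
    then show ?thesis
      using that by (auto simp: numeral_eq_Suc length_Suc_conv)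
  qed
  then show ?case
  proof cases
    case two
    then show ?thesis
      using less.prems by (auto intro!: fence_ok_two)
  next
    case four
    then show ?thesis
      using less.prems by (auto intro!: fence_ok_four)
  next
    case six
    have rot: "fence_ok c" if "fence_ok [a, d, x, y, z, b]"
      using that fence_ok_rotate1[of "[a, d, x, y, z]" b] six by simp
    have rot2: "fence_ok c" if "fence_ok [d, x, y, z, b, a]"
      using that fence_ok_rotate[of "[b, a]" "[d, x, y, z]"] six by simp
    have rot3: "fence_ok c" if "fence_ok [x, y, z, b, a, d]"
      using that fence_ok_rotate[of "[b, a, d]" "[x, y, z]"] six by simp
    have rot4: "fence_ok c" if "fence_ok [y, z, b, a, d, x]"
      using that fence_ok_rotate[of "[b, a, d, x]" "[y, z]"] six by simp
    have rot5: "fence_ok c" if "fence_ok [z, b, a, d, x, y]"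
      using that fence_ok_rotate[of "[b, a, d, x, y]" "[z]"] six by simp
    have pos: "0 \<notin> {b, a, d, x, y, z}" and gt: "0 < b" "0 < d" "0 < y"
      using less.prems six by auto
    show ?thesis
    \<comment> \<open>The triples \<open>b, d, y\<close> and \<open>a, x, z\<close> are the blocks
      of equal direction. Two ones in a triple are cyclically two places apart, so some rotation
      fits \<open>fence_ok_six_ones\<close>; otherwise two of \<open>b, d, y\<close> are at least
      2.\<close>
    proof (cases "b = 1 \<and> d = 1 \<or> d = 1 \<and> y = 1 \<or> y = 1 \<and> b = 1 \<or>
        a = 1 \<and> x = 1 \<or> x = 1 \<and> z = 1 \<or> z = 1 \<and> a = 1")
      case True
      then consider "b = 1" "d = 1" | "a = 1" "x = 1" | "d = 1" "y = 1" | "x = 1" "z = 1"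
        | "y = 1" "b = 1" | "z = 1" "a = 1"
        by blast
      then show ?thesis
      proof cases
        case 1
        then show ?thesis
          using six pos fence_ok_six_ones[of a x y z] by simp
      next
        case 2
        have "fence_ok [a, d, x, y, z, b]"
          using 2 pos fence_ok_six_ones[of d y z b] by simp
        then show ?thesis
          by (rule rot)
      next
        case 3
        have "fence_ok [d, x, y, z, b, a]"
          using 3 pos fence_ok_six_ones[of x z b a] by simp
        then show ?thesis
          by (rule rot2)
      next
        case 4
        have "fence_ok [x, y, z, b, a, d]"
          using 4 pos fence_ok_six_ones[of y b a d] by simp
        then show ?thesis
          by (rule rot3)
      next
        case 5
        have "fence_ok [y, z, b, a, d, x]"
          using 5 pos fence_ok_six_ones[of z a d x] by simp
        then show ?thesis
          by (rule rot4)
      next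
        case 6
        have "fence_ok [z, b, a, d, x, y]"
          using 6 pos fence_ok_six_ones[of b d x y] by simp
        then show ?thesis
          by (rule rot5)
      qed
    next
      case False
      consider "2 \<le> b" "2 \<le> d" | "2 \<le> d" "2 \<le> y" | "2 \<le> y" "2 \<le> b"
      proof -
        have "b = 1 \<or> 2 \<le> b" "d = 1 \<or> 2 \<le> d" "y = 1 \<or> 2 \<le> y"
          using gt by linarith+
        then show ?thesis
          using that False by blast
      qed
      then show ?thesis
      proof cases
        case 1
        have "fence_ok [b - 1, a, d - 1, x, y, z]"
          using 1 pos six by (intro less.hyps) (auto simp: exceptional_def)
        then have "fence_ok [b, a, d, x, y, z]"
          by (rule fence_ok_six_big[rotated 4]) (use 1 pos False in auto)
        then show ?thesis
          by (simp add: six)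
      next
        case 2
        have "fence_ok [d - 1, x, y - 1, z, b, a]"
          using 2 pos six by (intro less.hyps) (auto simp: exceptional_def)
        then have "fence_ok [d, x, y, z, b, a]"
          by (rule fence_ok_six_big[rotated 4]) (use 2 pos False in auto)
        then show ?thesis
          by (rule rot2)
      next
        case 3
        have "fence_ok [y - 1, z, b - 1, a, d, x]"
          using 3 pos six by (intro less.hyps) (auto simp: exceptional_def)
        then have "fence_ok [y, z, b, a, d, x]"
          by (rule fence_ok_six_big[rotated 4]) (use 3 pos False in auto)
        then show ?thesis
          by (rule rot4)
      qed
    qed
  next
    case long
    show ?thesis
    proof (cases "\<exists>b\<in>set c. b \<noteq> 1")
      case True
      then obtain b xs ys where c: "c = xs @ b # ys" "b \<noteq> 1"
        by (metis split_list)
      \<comment> \<open>Rotation puts the part \<open>b > 1\<close> first, so that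
        \<open>b - 1\<close> stays positive in the exchange.\<close>
      obtain a d zs where zs: "ys @ xs = a # d # zs"
      proof -
        define l where "l = ys @ xs"
        have "2 \<le> length l" using long c by (simp add: l_def)
        then obtain a d zs where "l = a # d # zs"
          by (cases l; cases "tl l") auto
        then show ?thesis
          using that by (simp add: l_def)
      qed
      have len: "length xs + length ys = Suc (Suc (length zs))"
        using arg_cong[OF zs, of length] by simp
      have sums: "sum_list xs + sum_list ys = a + d + sum_list zs"
        using arg_cong[OF zs, of sum_list] by simp
      have sets: "set xs \<union> set ys = {a, d} \<union> set zs"
        using arg_cong[OF zs, of set] by auto
      have "fence_ok (b # a # d # zs)"
      proof (rule fence_ok_long)
        fix c' assume "sum_list c' + length c' < sum_list (b # a # d # zs) + length (b # a # d # zs)"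
          "0 \<notin> set c'" "even (length c')" "6 \<le> length c'"
        then show "fence_ok c'"
          using c len sums by (intro less.hyps) (auto simp: exceptional_def)
      next
        have "0 \<notin> {b, a, d} \<union> set zs"
          using less.prems c sets by auto
        then show "2 \<le> b" "0 < a" "0 < d" "0 \<notin> set zs"
          using c by auto
        show "odd (length zs)" "5 \<le> length zs"
          using less.prems long c len by auto
      qed
      then show ?thesis
        using fence_ok_rotate[of xs "b # ys"] less.prems c zs by simp
    next
      case False
      then have "c = replicate (length c) 1"
        by (simp add: replicate_eqI)
      moreover obtain k where k: "length c = k + 3"
        using long by (intro that[of "length c - 3"]) auto
      ultimately have c: "c = 1 # 1 # 1 # replicate k 1"
        by (simp add: numeral_3_eq_3)
      show ?thesis
        unfolding c
      proof (rule fence_ok_all_ones)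
        fix c' :: "nat list"
        assume "0 \<notin> set c'" "even (length c')" "4 \<le> length c'" "length c' < k + 3"
          "sum_list c' \<le> k + 3" "\<not> exceptional c'"
        then show "fence_ok c'"
          by (intro less.hyps) (auto simp: c sum_list_replicate)
      qed (use less.prems long k in auto)
    qed
  qed
qed

section \<open>Lower ideals as closed walks\<close>

text \<open>An ideal is read as the sequence of its membership bits. \<open>w\<close> lists the directions of the
  steps; position \<open>length w\<close> lies outside the set and carries the final bit \<open>t\<close>.\<close>
definition walk_bit :: "nat \<Rightarrow> nat set \<Rightarrow> bool \<Rightarrow> nat \<Rightarrow> bool" where
  "walk_bit n I t i \<longleftrightarrow> (if i = n then t else i \<in> I)"

definition allowed :: "bool \<Rightarrow> bool \<Rightarrow> bool \<Rightarrow> bool" where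
  "allowed x s t \<longleftrightarrow> (if x then t \<longrightarrow> s else s \<longrightarrow> t)"

definition walks :: "bool list \<Rightarrow> bool \<Rightarrow> bool \<Rightarrow> nat set set" where
  "walks w s t = {I. I \<subseteq> {..<length w} \<and> walk_bit (length w) I t 0 = s \<and>
     (\<forall>i<length w. allowed (w ! i) (i \<in> I) (walk_bit (length w) I t (Suc i)))}"

lemma finite_walks: "finite (walks w s t)"
  by (rule finite_subset[of _ "Pow {..<length w}"]) (auto simp: walks_def)

lemma entry2_step_mat:
  "entry2 (step_mat x) s t = (if allowed x s t then if s then q else 1 else 0)"
  by (cases x) (auto simp: allowed_def)

text \<open>Position \<open>length w\<close> turns from end marker into a genuine element, whose
  membership is the final bit of the walk along \<open>w\<close>.\<close>

lemma walks_snoc: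
  "walks (w @ [x]) s t =
     (if allowed x False t then walks w s False else {}) \<union>
     (if allowed x True t then insert (length w) ` walks w s True else {})"
proof -
  let ?n = "length w"
  have last: "walk_bit (Suc ?n) I t (Suc ?n) = t" for I
    by (simp add: walk_bit_def)
  have out: "I \<in> walks (w @ [x]) s t \<longleftrightarrow> allowed x False t \<and> I \<in> walks w s False"
    if "?n \<notin> I" for I
  proof -
    have "walk_bit (Suc ?n) I t i = walk_bit ?n I False i" if "i \<le> ?n" for i
      using that \<open>?n \<notin> I\<close> by (auto simp: walk_bit_def)
    then show ?thesis
      using that by (auto simp: walks_def All_less_Suc nth_append last less_Suc_eq lessThan_Suc)
  qed
  have ins: "insert ?n I \<in> walks (w @ [x]) s t \<longleftrightarrow> allowed x True t \<and> I \<in> walks w s True"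
    if "?n \<notin> I" for I
  proof -
    have "walk_bit (Suc ?n) (insert ?n I) t i = walk_bit ?n I True i" if "i \<le> ?n" for i
      using that by (auto simp: walk_bit_def)
    then show ?thesis
      using that by (auto simp: walks_def All_less_Suc nth_append last less_Suc_eq lessThan_Suc)
  qed
  have notin: "?n \<notin> I" if "I \<in> walks w s u" for I u
    using that by (auto simp: walks_def)
  show ?thesis
  proof (intro set_eqI)
    fix I
    show "I \<in> walks (w @ [x]) s t \<longleftrightarrow> I \<in> (if allowed x False t then walks w s False else {}) \<union>
        (if allowed x True t then insert ?n ` walks w s True else {})"
    proof (cases "?n \<in> I")
      case True
      then obtain J where "I = insert ?n J" "?n \<notin> J"
        by (meson Set.set_insert)
      then show ?thesis
        using ins[of J] notin by (auto simp: insert_ident)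
    next
      case False
      then show ?thesis
        using out[of I] by auto
    qed
  qed
qed

text \<open>The end bit \<open>t\<close> carries no weight, so a closed walk counts every element
  exactly once.\<close>

lemma entry2_walks:
  "entry2 (prod_list (map step_mat w)) s t = (\<Sum>I\<in>walks w s t. q ^ card I)"
proof (induction w arbitrary: t rule: rev_induct)
  case Nil
  have "walks [] s t = (if s = t then {{}} else {})"
    by (auto simp: walks_def walk_bit_def)
  then show ?case
    by (simp add: one_mat2_def)
next
  case (snoc x w)
  let ?n = "length w"
  have notin: "?n \<notin> I" "finite I" if "I \<in> walks w s u" for I u
    using that finite_subset by (auto simp: walks_def)
  have "(\<Sum>I\<in>insert ?n ` walks w s True. q ^ card I) = (\<Sum>I\<in>walks w s True. q ^ card I * q)"
    by (subst sum.reindex) (auto simp: inj_on_def insert_ident notin mult.commute)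
  moreover have "walks w s False \<inter> insert ?n ` walks w s True = {}"
    using notin by blast
  ultimately show ?case
    by (auto simp: walks_snoc sum.union_disjoint finite_walks entry2_mult entry2_step_mat snoc.IH
        sum_distrib_right)
qed

lemma prod_list_fence_steps: "prod_list (map step_mat (fence_steps c)) = fence_mat True c"
proof -
  \<comment> \<open>The parity is compared with a variable \<open>u\<close> because it flips on
    passing to the tail.\<close>
  have *: "prod_list (map step_mat (concat (map (\<lambda>j. replicate (c ! j) (even j = u)) [0..<length c])))
      = fence_mat u c" for u
  proof (induction c arbitrary: u)
    case (Cons k c)
    have "(odd j = u) = (even j = (\<not> u))" for j :: nat
      by auto
    moreover have "[0..<length (k # c)] = 0 # map Suc [0..<length c]"
      by (simp add: map_Suc_upt upt_conv_Cons del: upt_Suc)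
    ultimately show ?case
      using Cons.IH[of "\<not> u"] by (simp add: comp_def map_replicate prod_list_replicate del: upt_Suc)
  qed simp
  show ?thesis
    using *[of True] by (simp add: fence_steps_def)
qed

lemma length_fence_steps: "length (fence_steps c) = sum_list c"
  by (simp add: fence_steps_def length_concat comp_def map_nth)

lemma ofilter_circular_fence:
  "Order_Relation.ofilter (circular_fence c) I \<longleftrightarrow>
     I \<subseteq> {..<sum_list c} \<and> (\<forall>(x, y)\<in>circular_fence_gen c. y \<in> I \<longrightarrow> x \<in> I)"
proof -
  let ?g = "circular_fence_gen c"
  have carrier: "x < sum_list c \<and> y < sum_list c" if "(x, y) \<in> ?g" for x y
    using that by (auto simp: circular_fence_gen_def)
  have closed: "x \<in> I" if "(x, y) \<in> ?g\<^sup>*" "y \<in> I" "\<forall>(x, y)\<in>?g. y \<in> I \<longrightarrow> x \<in> I" for x y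
    using that by (induction rule: converse_rtrancl_induct) auto
  show ?thesis
    unfolding Order_Relation.ofilter_def Field_circular_fence circular_fence_carrier_def under_def
    using carrier closed by (fastforce simp: circular_fence_def circular_fence_carrier_def)
qed

lemma circular_fence_closed_iff:
  assumes "I \<subseteq> {..<sum_list c}"
  shows "(\<forall>(x, y)\<in>circular_fence_gen c. y \<in> I \<longrightarrow> x \<in> I) \<longleftrightarrow> I \<in> walks (fence_steps c) (0 \<in> I) (0 \<in> I)"
proof -
  let ?n = "sum_list c"
  \<comment> \<open>At the last step the successor wraps to 0, whose bit is the prescribed end
    bit.\<close>
  have next_bit: "walk_bit ?n I (0 \<in> I) (Suc i) \<longleftrightarrow> Suc i mod ?n \<in> I" if "i < ?n" for i
    using that by (cases "Suc i = ?n") (auto simp: walk_bit_def)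
  have "(\<forall>(x, y)\<in>circular_fence_gen c. y \<in> I \<longrightarrow> x \<in> I) \<longleftrightarrow>
      (\<forall>i<?n. allowed (fence_steps c ! i) (i \<in> I) (Suc i mod ?n \<in> I))"
    unfolding circular_fence_gen_def allowed_def by fastforce
  moreover have "walk_bit ?n I (0 \<in> I) 0 = (0 \<in> I)"
    by (simp add: walk_bit_def)
  ultimately show ?thesis
    using assms(1) by (simp add: walks_def length_fence_steps next_bit)
qed

text \<open>A nonzero sum makes 0 a genuine element; its bit separates the two diagonal entries of
  the trace.\<close>

lemma rank_polynomial_circular_fence:
  assumes "sum_list c \<noteq> 0"
  shows "rank_polynomial (circular_fence c) = fence_poly True c"
proof -
  let ?w = "walks (fence_steps c)"
  have bit: "0 \<in> I \<longleftrightarrow> s" if "I \<in> ?w s t" for I s t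
    using that assms
    by (auto simp: walks_def walk_bit_def length_fence_steps simp del: sum_list_eq_0_iff split: if_splits)
  have "Order_Relation.ofilter (circular_fence c) I \<longleftrightarrow> I \<in> ?w False False \<union> ?w True True" for I
    using bit[of I] circular_fence_closed_iff[of I c]
    unfolding ofilter_circular_fence by (auto simp: walks_def length_fence_steps)
  then have "{I. Order_Relation.ofilter (circular_fence c) I} = ?w False False \<union> ?w True True"
    by blast
  moreover have "?w False False \<inter> ?w True True = {}"
    using bit by blast
  ultimately have "rank_polynomial (circular_fence c)
      = (\<Sum>I\<in>?w False False. q ^ card I) + (\<Sum>I\<in>?w True True. q ^ card I)"
    by (simp add: rank_polynomial_def sum.union_disjoint finite_walks q_def monom_power)
  then show ?thesis
    by (simp add: fence_poly_def trace2_entry2 entry2_walks flip: prod_list_fence_steps)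
qed

theorem theorem5p1:
  fixes a :: "nat list"
  assumes "composition a"
    and "even (length a)"
    and "\<not> (\<exists>k::nat. 0 < k \<and> (a = [k, 1, k, 1] \<or> a = [1, k, 1, k]))"
  shows "unimodal (rank_polynomial (circular_fence a))"
proof (cases "a = []")
  case True
  \<comment> \<open>The empty fence has rank polynomial 1, whereas the empty trace is 2, so it is
    treated apart.\<close>
  have "{I. Order_Relation.ofilter (circular_fence []) I} = {{}}"
    by (auto simp: Order_Relation.ofilter_def Field_circular_fence circular_fence_carrier_def)
  then show ?thesis
    using True by (simp add: rank_polynomial_def unimodal_def)
next
  case False
  have pos: "0 \<notin> set a"
    using assms(1) by (auto simp: composition_def)
  then have "\<not> exceptional a"
    using assms(3) unfolding exceptional_def by (metis gr0I list.set_intros)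
  then have "fence_ok a"
    using pos assms(2) False by (intro fence_ok_composition)
  moreover have "sum_list a \<noteq> 0"
    using pos False by (cases a) auto
  ultimately show ?thesis
    by (auto simp: fence_ok_def rank_polynomial_circular_fence intro: sl2_char_unimodal)
qed

end
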